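(* Let $p>2$ be a prime and $k$ a field of characteristic $p$. Let $I: i_1<i_2<\cdots$ be any increasing sequence of positive integers (finite with at least two terms, or infinite), and let $L_{\infty,I}$ be the $T$-space of $k_0\langle X\rangle$ generated by $\{x_1^px_2^p\cdots x_i^p : i\in I\}$. Then $L_{\infty,I}$ is finitely based; more precisely, it has a $T$-space basis of size at most $i_2-i_1+1$.
   Context: $X=\{x_1,x_2,\ldots\}$ is countably infinite; $k_0\langle X\rangle$ is the free associative (non-unital) $k$-algebra on $X$. A $T$-space is a $k$-subspace of $k_0\langle X\rangle$ invariant under every algebra endomorphism of $k_0\langle X\rangle$ (closed under substituting arbitrary elements for the variables). A $T$-space basis of a $T$-space $V$ is a subset that generates $V$ as a $T$-space. *)

theory Defs
  imports Main "HOL-Library.Poly_Mapping" "HOL-Computational_Algebra.Primes"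
begin

text \<open>Noncommutative polynomials over k in the variables x_0, x_1, ... (indexed by nat):
  finitely supported maps from words (lists of variable indices) to coefficients.
  The free non-unital algebra k_0<X> consists of those with zero constant term.\<close>

type_synonym 'k ncpoly = "nat list \<Rightarrow>\<^sub>0 'k"

definition free0 :: "'k::field ncpoly set" where
  "free0 = {f. Poly_Mapping.lookup f [] = 0}"

definition nc_smult :: "'k::field \<Rightarrow> 'k ncpoly \<Rightarrow> 'k ncpoly" where
  "nc_smult c f = Poly_Mapping.map (\<lambda>a. c * a) f"

definition nc_mult :: "'k::field ncpoly \<Rightarrow> 'k ncpoly \<Rightarrow> 'k ncpoly" where
  "nc_mult f g = (\<Sum>u\<in>Poly_Mapping.keys f. \<Sum>v\<in>Poly_Mapping.keys g.
      Poly_Mapping.single (u @ v) (Poly_Mapping.lookup f u * Poly_Mapping.lookup g v))"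

fun word_eval :: "(nat \<Rightarrow> 'k::field ncpoly) \<Rightarrow> nat list \<Rightarrow> 'k ncpoly" where
  "word_eval \<sigma> [] = 0"
| "word_eval \<sigma> [i] = \<sigma> i"
| "word_eval \<sigma> (i # w) = nc_mult (\<sigma> i) (word_eval \<sigma> w)"

definition nc_subst :: "(nat \<Rightarrow> 'k::field ncpoly) \<Rightarrow> 'k ncpoly \<Rightarrow> 'k ncpoly" where
  "nc_subst \<sigma> f = (\<Sum>w\<in>Poly_Mapping.keys f. nc_smult (Poly_Mapping.lookup f w) (word_eval \<sigma> w))"

definition T_space :: "'k::field ncpoly set \<Rightarrow> bool" where
  "T_space V \<longleftrightarrow> V \<subseteq> free0 \<and> 0 \<in> V
     \<and> (\<forall>f\<in>V. \<forall>g\<in>V. f + g \<in> V)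
     \<and> (\<forall>c. \<forall>f\<in>V. nc_smult c f \<in> V)
     \<and> (\<forall>\<sigma>. (\<forall>i. \<sigma> i \<in> free0) \<longrightarrow> (\<forall>f\<in>V. nc_subst \<sigma> f \<in> V))"

definition T_span :: "'k::field ncpoly set \<Rightarrow> 'k ncpoly set" where
  "T_span S = \<Inter>{V. T_space V \<and> S \<subseteq> V}"

definition pow_mono :: "nat \<Rightarrow> nat \<Rightarrow> 'k::field ncpoly" where
  "pow_mono p i = Poly_Mapping.single (concat (List.map (\<lambda>j. replicate p j) [1..<i+1])) 1"

end

(*
Write P n for the span of the products x_1^p ... x_n^p and h(x,y) = sum_{i<p} x^i y x^(p-1-i), an
element of P 1. Polarising h(x,y) x = h(x,yx) gives h(x,y) z - h(x,z) y in P 1. Let d > 0 and v in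
P d. Since each P n is stable under commutators, it follows that P (n-1) maps the two-sided ideal
generated by the h(x,v) into P n + P (n+d). Modulo this ideal P 1 commutes with P d, and h(x,y) v
lies in P 1; hence commutators and the defects (x+y)^p - x^p - y^p are harmless inside long
products (this uses p > 2), and d pairs of factors can be contracted through
(x+y)^p (x+y)^p = ((x+y)^2)^p. So P m is contained in P (m-d) + P n + P (n+d) for m >= n + 2d. With
n = i_1 and n + d = i_2, it suffices to keep i_2 and the least element of I in each residue class
modulo d.
*)

theory Submission
  imports Defs "HOL.Vector_Spaces"
begin

section \<open>Words as a monoid; extraction of coefficients\<close>

instantiation list :: (type) monoid_add
begin

definition zero_list :: "'a list" where "zero_list = []"

text \<open>Multiplication of \<open>poly_mapping\<close>s is convolution over an additive monoid.
  With concatenation as \<open>+\<close>, \<open>*\<close> on \<open>ncpoly\<close> is the product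
  of the unital free algebra.\<close>

definition plus_list :: "'a list \<Rightarrow> 'a list \<Rightarrow> 'a list" where "plus_list = (@)"

instance
  by intro_classes (simp_all add: zero_list_def plus_list_def)

end

text \<open>Vandermonde, by induction: \<open>f(t) - f(m)\<close> is divided by \<open>t - m\<close>.\<close>

lemma (in vector_space) coeffs_in_subspace:
  assumes V: "subspace V" and "finite L" "card L > N"
    and "\<And>t. t \<in> L \<Longrightarrow> (\<Sum>k\<le>N. scale (t ^ k) (c k)) \<in> V"
    and "k \<le> N"
  shows "c k \<in> V"
  using assms(2-)
proof (induction N arbitrary: L c k)
  case 0
  then obtain t where "t \<in> L" by fastforce
  with 0 show ?case by force
next
  case (Suc N)
  then obtain m where m: "m \<in> L" by fastforce
  \<comment> \<open>Coefficients of the quotient by \<open>t - m\<close>, as in Horner's scheme: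
    \<open>d k\<close> is \<open>c (Suc k)\<close> plus \<open>m\<close> times
    \<open>d (Suc k)\<close>.\<close>
  define d where "d k = (\<Sum>j\<in>{k<..Suc N}. scale (m ^ (j - Suc k)) (c j))" for k
  have quotient: "scale (t - m) (\<Sum>k\<le>N. scale (t ^ k) (d k))
      = (\<Sum>k\<le>Suc N. scale (t ^ k) (c k)) - (\<Sum>k\<le>Suc N. scale (m ^ k) (c k))" for t
  proof -
    have "(\<Sum>k\<le>Suc N. scale (t ^ k) (c k)) - (\<Sum>k\<le>Suc N. scale (m ^ k) (c k))
      = (\<Sum>j\<le>Suc N. scale (t ^ j - m ^ j) (c j))"
      by (simp add: sum_subtractf scale_left_diff_distrib del: sum.atMost_Suc)
    also have "\<dots> = (\<Sum>j\<le>Suc N. \<Sum>k<j. scale ((t - m) * (m ^ (j - Suc k) * t ^ k)) (c j))"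
      by (intro sum.cong refl) (simp add: power_diff_sumr2 sum_distrib_left scale_sum_left ac_simps)
    also have "\<dots> = (\<Sum>j\<le>Suc N. \<Sum>k\<in>{k. k \<le> N \<and> k < j}. scale ((t - m) * (m ^ (j - Suc k) * t ^ k)) (c j))"
      by (intro sum.cong refl) auto
    also have "\<dots> = (\<Sum>k\<le>N. \<Sum>j\<in>{j. j \<le> Suc N \<and> k < j}. scale ((t - m) * (m ^ (j - Suc k) * t ^ k)) (c j))"
      using sum.swap_restrict[of "{..Suc N}" "{..N}" "\<lambda>j k. scale ((t - m) * (m ^ (j - Suc k) * t ^ k)) (c j)" "\<lambda>j k. k < j"]
      by simp
    also have "\<dots> = scale (t - m) (\<Sum>k\<le>N. scale (t ^ k) (d k))"
      unfolding d_def scale_sum_right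
      by (intro sum.cong refl) (auto simp: scale_scale ac_simps)
    finally show ?thesis by simp
  qed
  \<comment> \<open>The quotient has degree at most \<open>N\<close>, and its values at the points
    other than \<open>m\<close> lie in \<open>V\<close>.\<close>
  have d: "d k \<in> V" if "k \<le> N" for k
  proof (rule Suc.IH[of "L - {m}"])
    fix t assume t: "t \<in> L - {m}"
    have "scale (t - m) (\<Sum>k\<le>N. scale (t ^ k) (d k)) \<in> V"
      unfolding quotient using t m Suc.prems(3) V by (blast intro: subspace_diff)
    then have "scale (inverse (t - m)) (scale (t - m) (\<Sum>k\<le>N. scale (t ^ k) (d k))) \<in> V"
      using V by (rule subspace_scale[rotated])
    then show "(\<Sum>k\<le>N. scale (t ^ k) (d k)) \<in> V" using t by simp
  qed (use Suc.prems m that in auto)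
  have c: "c (Suc k) \<in> V" if "k \<le> N" for k
  proof -
    have "{k<..Suc N} = insert (Suc k) {Suc k<..Suc N}" using that by auto
    then have "d k = c (Suc k) + (\<Sum>j\<in>{Suc k<..Suc N}. scale (m ^ (j - Suc k)) (c j))"
      by (simp add: d_def)
    also have "(\<Sum>j\<in>{Suc k<..Suc N}. scale (m ^ (j - Suc k)) (c j)) = scale m (d (Suc k))"
      unfolding d_def scale_sum_right
      by (intro sum.cong refl) (auto simp: scale_scale simp flip: power_Suc Suc_diff_le)
    finally have *: "c (Suc k) = d k - scale m (d (Suc k))" by simp
    \<comment> \<open>For \<open>k = N\<close> the sum defining \<open>d (Suc N)\<close> is
      empty.\<close>
    have "d (Suc k) \<in> V"
      using d[of "Suc k"] subspace_0[OF V] that by (cases "k = N") (auto simp: d_def)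
    then show ?thesis
      unfolding * using d that V by (intro subspace_diff subspace_scale)
  qed
  show ?case
  proof (cases k)
    case 0
    have "c 0 = (\<Sum>k\<le>Suc N. scale (m ^ k) (c k)) - (\<Sum>k\<le>N. scale (m ^ Suc k) (c (Suc k)))"
      by (simp add: sum.atMost_Suc_shift del: sum.atMost_Suc)
    also have "\<dots> \<in> V"
      using Suc.prems(3) m c V by (blast intro: subspace_diff subspace_sum subspace_scale)
    finally show ?thesis using 0 by simp
  qed (use c Suc.prems in auto)
qed

section \<open>Formal expansion of powers and of their derivatives\<close>

text \<open>The coefficients of \<open>t ^ k\<close> in \<open>(x + t y) ^ n\<close>; then the derivative of \<open>x ^ n\<close> in direction \<open>y\<close>
  (which is \<open>h(x, y)\<close> for \<open>n = p\<close>), and the coefficients of \<open>t ^ k\<close> in that derivative taken at \<open>x + t v\<close>.\<close>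

fun binomial_words :: "'a::ring_1 \<Rightarrow> 'a \<Rightarrow> nat \<Rightarrow> nat \<Rightarrow> 'a" where
  "binomial_words x y 0 k = (if k = 0 then 1 else 0)"
| "binomial_words x y (Suc n) k
    = x * binomial_words x y n k + (if k = 0 then 0 else y * binomial_words x y n (k - 1))"

fun power_deriv :: "'a::ring_1 \<Rightarrow> 'a \<Rightarrow> nat \<Rightarrow> 'a" where
  "power_deriv x y 0 = 0"
| "power_deriv x y (Suc n) = x * power_deriv x y n + y * x ^ n"

fun power_deriv_words :: "'a::ring_1 \<Rightarrow> 'a \<Rightarrow> 'a \<Rightarrow> nat \<Rightarrow> nat \<Rightarrow> 'a" where
  "power_deriv_words x v y 0 k = 0"
| "power_deriv_words x v y (Suc n) k
    = x * power_deriv_words x v y n k + (if k = 0 then 0 else v * power_deriv_words x v y n (k - 1))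
      + y * binomial_words x v n k"

lemma binomial_words_0 [simp]: "binomial_words x y n 0 = x ^ n"
  by (induction n) auto

lemma binomial_words_gt: "n < k \<Longrightarrow> binomial_words x y n k = 0"
  by (induction n arbitrary: k) auto

lemma binomial_words_diag [simp]: "binomial_words x y n n = y ^ n"
  by (induction n) (auto simp: binomial_words_gt)

lemma binomial_words_1: "binomial_words x y n 1 = power_deriv x y n"
  by (induction n) auto

lemma power_deriv_words_0 [simp]: "power_deriv_words x v y n 0 = power_deriv x y n"
  by (induction n) auto

lemma power_deriv_words_ge: "n \<le> k \<Longrightarrow> power_deriv_words x v y n k = 0"
  by (induction n arbitrary: k) (auto simp: binomial_words_gt)

text \<open>The derivative has degree \<open>n\<close> in \<open>x + t v\<close>, so the coefficient
  of \<open>t ^ n\<close> takes \<open>v\<close> at every such place.\<close>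

lemma power_deriv_words_last: "power_deriv_words x v y (Suc n) n = power_deriv v y (Suc n)"
proof (induction n)
  case (Suc n)
  show ?case
    unfolding power_deriv_words.simps(2)[of x v y "Suc n" "Suc n"] power_deriv.simps(2)[of v y "Suc n"]
    by (simp only: Suc.IH diff_Suc_1) (simp add: power_deriv_words_ge del: power_deriv_words.simps binomial_words.simps power_deriv.simps)
qed simp

text \<open>Both sides are the mixed second derivative of \<open>x ^ n\<close> in the directions
  \<open>y\<close> and \<open>v\<close>.\<close>

lemma power_deriv_words_1_commute: "power_deriv_words x v y n 1 = power_deriv_words x y v n 1"
  by (induction n) (simp_all add: binomial_words_1[simplified] algebra_simps)

text \<open>Differentiating (x + t y)^n with respect to t gives its derivative in direction
  \<open>y\<close> at x + t y; coefficients of t^k are compared.\<close>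

lemma power_deriv_words_same:
  "power_deriv_words x y y n k = of_nat (Suc k) * binomial_words x y n (Suc k)"
proof (induction n arbitrary: k)
  case (Suc n)
  show ?case
  proof (cases k)
    case 0
    then show ?thesis using Suc[of 0] by simp
  next
    case (Suc l)
    have comm: "y * (of_nat m * z) = of_nat m * (y * z)" for m z
      by (metis mult.assoc mult_of_nat_commute)
    have comm': "x * (of_nat m * z) = of_nat m * (x * z)" for m z
      by (metis mult.assoc mult_of_nat_commute)
    show ?thesis
      unfolding power_deriv_words.simps Suc.IH using Suc
      by (simp del: of_nat_Suc add: comm comm' distrib_left) (simp add: algebra_simps)
  qed
qed auto

lemma power_deriv_mult_right: "power_deriv x (y * x) n = power_deriv x y n * x"
  by (induction n) (simp_all add: algebra_simps power_commutes)

lemma power_deriv_mult_left: "power_deriv x (x * y) n = x * power_deriv x y n"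
  by (induction n) (simp_all add: algebra_simps)

lemma power_deriv_diff: "power_deriv x (y - z) n = power_deriv x y n - power_deriv x z n"
  by (induction n) (simp, simp only: power_deriv.simps, simp add: ring_distribs)

text \<open>The sum of x^i (x y - y x) x^(n-1-i) telescopes.\<close>

lemma power_deriv_commutator: "power_deriv x (x * y - y * x) n = x ^ n * y - y * x ^ n"
  by (induction n) (simp, simp only: power_deriv.simps, simp add: ring_distribs mult.assoc power_commutes)

section \<open>Algebras in odd characteristic p\<close>

locale char_p_algebra = vector_space scale
  for scale :: "'k::field \<Rightarrow> 'a::ring_1 \<Rightarrow> 'a" (infixr "*s" 75) +
  fixes p :: nat and A :: "'a set"
  assumes scale_mult_left: "(c *s x) * y = c *s (x * y)"
    and scale_mult_right: "x * (c *s y) = c *s (x * y)"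
    and prime_p: "prime p" and p_gt_2: "p > 2" and CHAR_eq: "CHAR('k) = p"
    and subspace_A: "subspace A"
    and mult_A: "x \<in> A \<Longrightarrow> y \<in> A \<Longrightarrow> x * y \<in> A"
begin

text \<open>Linearity of multiplications and commutators, in the form that
  \<open>span_induct\<close> asks for.\<close>

lemma subspace_mult_preimage:
  assumes "subspace V"
  shows "subspace {x. a * x \<in> V}" "subspace {x. x * b \<in> V}" "subspace {x. x * b - b * x \<in> V}"
proof -
  show "subspace {x. a * x \<in> V}" "subspace {x. x * b \<in> V}"
    using assms by (simp_all add: subspace_def ring_distribs scale_mult_left scale_mult_right)
  have "(x + y) * b - b * (x + y) = (x * b - b * x) + (y * b - b * y)"
    and "(c *s x) * b - b * (c *s x) = c *s (x * b - b * x)" for x y c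
    by (simp_all add: algebra_simps scale_mult_left scale_mult_right scale_right_diff_distrib)
  then show "subspace {x. x * b - b * x \<in> V}"
    using assms by (simp add: subspace_def)
qed

lemma span_mult:
  assumes "u \<in> span S" "v \<in> span T" "subspace V" "\<And>x y. x \<in> S \<Longrightarrow> y \<in> T \<Longrightarrow> x * y \<in> V"
  shows "u * v \<in> V"
proof -
  have "x * v \<in> V" if "x \<in> S" for x
    using span_induct[OF assms(2) subspace_mult_preimage(1)[OF assms(3)]] assms(4) that by simp
  then show ?thesis
    using span_induct[OF assms(1) subspace_mult_preimage(2)[OF assms(3)]] by simp
qed

lemma of_nat_mult_eq_scale: "of_nat n * x = of_nat n *s x"
  by (induction n) (auto simp: algebra_simps scale_left_distrib)

lemma two_neq_0: "(2 :: 'k) \<noteq> 0"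
  using of_nat_eq_0_iff_char_dvd[of 2, where 'a = 'k] p_gt_2 by (auto simp: CHAR_eq dest: dvd_imp_le)

text \<open>The field may have only p elements, which is enough for degree below p. Hence the
  coefficient of \<open>t ^ p\<close> must be known to lie in \<open>V\<close> and is subtracted
  first.\<close>

lemma coeffs_in_subspace_char:
  assumes V: "subspace V" and f: "\<And>t. (\<Sum>k\<le>p. t ^ k *s c k) \<in> V" and "c p \<in> V" "k \<le> p"
  shows "c k \<in> V"
proof (cases "k = p")
  case False
  let ?L = "(of_nat :: nat \<Rightarrow> 'k) ` {..<p}"
  have "inj_on (of_nat :: nat \<Rightarrow> 'k) {..<p}"
  proof (rule linorder_inj_onI)
    fix i j assume "i < j" "i \<in> {..<p}" "j \<in> {..<p}"
    then have "\<not> p dvd j - i" by (auto dest: dvd_imp_le)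
    then have "(of_nat (j - i) :: 'k) \<noteq> 0" by (simp add: of_nat_eq_0_iff_char_dvd CHAR_eq)
    then show "(of_nat i :: 'k) \<noteq> of_nat j" using \<open>i < j\<close> by (auto simp: of_nat_diff)
  qed auto
  then have L: "card ?L = p" by (simp add: card_image)
  have sub: "(\<Sum>k\<le>p - 1. t ^ k *s c k) \<in> V" for t
  proof -
    have "(\<Sum>k\<le>p - 1. t ^ k *s c k) = (\<Sum>k\<le>p. t ^ k *s c k) - t ^ p *s c p"
      using p_gt_2 by (cases p) auto
    then show ?thesis using V f \<open>c p \<in> V\<close> by (simp add: subspace_diff subspace_scale)
  qed
  show ?thesis
    by (rule coeffs_in_subspace[OF V, of ?L "p - 1"])
       (use p_gt_2 sub L False \<open>k \<le> p\<close> in auto)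
qed (use assms in simp)

lemma power_add_scale: "(x + t *s y) ^ n = (\<Sum>k\<le>n. t ^ k *s binomial_words x y n k)"
proof (induction n)
  case (Suc n)
  have "(x + t *s y) ^ Suc n = (\<Sum>k\<le>n. t ^ k *s (x * binomial_words x y n k))
      + (\<Sum>k\<le>n. t ^ Suc k *s (y * binomial_words x y n k))"
    by (simp add: Suc distrib_right sum_distrib_left scale_sum_right scale_mult_left scale_mult_right ac_simps scale_right_distrib sum.distrib)
  also have "(\<Sum>k\<le>n. t ^ k *s (x * binomial_words x y n k)) = (\<Sum>k\<le>Suc n. t ^ k *s (x * binomial_words x y n k))"
    by (simp add: binomial_words_gt)
  also have "(\<Sum>k\<le>n. t ^ Suc k *s (y * binomial_words x y n k))
      = (\<Sum>k\<le>Suc n. t ^ k *s (if k = 0 then 0 else y * binomial_words x y n (k - 1)))"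
    by (simp add: sum.atMost_Suc_shift del: sum.atMost_Suc)
  finally show ?case by (simp add: sum.distrib scale_right_distrib)
qed simp

lemma power_deriv_add_scale:
  "power_deriv (x + t *s v) y n = (\<Sum>k\<le>n. t ^ k *s power_deriv_words x v y n k)"
proof (induction n)
  case (Suc n)
  have "power_deriv (x + t *s v) y (Suc n) = (\<Sum>k\<le>n. t ^ k *s (x * power_deriv_words x v y n k))
      + (\<Sum>k\<le>n. t ^ Suc k *s (v * power_deriv_words x v y n k))
      + (\<Sum>k\<le>n. t ^ k *s (y * binomial_words x v n k))"
    by (simp add: Suc power_add_scale distrib_right sum_distrib_left scale_sum_right scale_mult_left scale_mult_right ac_simps scale_right_distrib sum.distrib)
  also have "(\<Sum>k\<le>n. t ^ k *s (x * power_deriv_words x v y n k)) = (\<Sum>k\<le>Suc n. t ^ k *s (x * power_deriv_words x v y n k))"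
    by (simp add: power_deriv_words_ge)
  also have "(\<Sum>k\<le>n. t ^ k *s (y * binomial_words x v n k)) = (\<Sum>k\<le>Suc n. t ^ k *s (y * binomial_words x v n k))"
    by (simp add: binomial_words_gt)
  also have "(\<Sum>k\<le>n. t ^ Suc k *s (v * power_deriv_words x v y n k))
      = (\<Sum>k\<le>Suc n. t ^ k *s (if k = 0 then 0 else v * power_deriv_words x v y n (k - 1)))"
    by (simp add: sum.atMost_Suc_shift del: sum.atMost_Suc)
  finally show ?case by (simp add: sum.distrib scale_right_distrib)
qed simp

section \<open>Products of p-th powers\<close>

text \<open>\<open>P 0\<close> is the space of scalars, which occurs below as \<open>P a\<close>
  when the least index is 1.\<close>

definition P :: "nat \<Rightarrow> 'a set" where
  "P n = span {prod_list (map (\<lambda>x. x ^ p) xs) | xs. length xs = n \<and> set xs \<subseteq> A}"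

lemma subspace_P: "subspace (P n)"
  by (simp add: P_def)

lemma P_mult: "u \<in> P m \<Longrightarrow> v \<in> P n \<Longrightarrow> u * v \<in> P (m + n)"
  unfolding P_def
proof (erule (1) span_mult)
  fix x y
  assume "x \<in> {prod_list (map (\<lambda>x. x ^ p) xs) | xs. length xs = m \<and> set xs \<subseteq> A}"
    and "y \<in> {prod_list (map (\<lambda>x. x ^ p) xs) | xs. length xs = n \<and> set xs \<subseteq> A}"
  then obtain xs ys where "x = prod_list (map (\<lambda>x. x ^ p) xs)" "length xs = m" "set xs \<subseteq> A"
    "y = prod_list (map (\<lambda>x. x ^ p) ys)" "length ys = n" "set ys \<subseteq> A" by blast
  then show "x * y \<in> span {prod_list (map (\<lambda>x. x ^ p) xs) | xs. length xs = m + n \<and> set xs \<subseteq> A}"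
    by (intro span_base CollectI exI[of _ "xs @ ys"]) auto
qed simp

lemma P_Suc_mult: "u \<in> P 1 \<Longrightarrow> v \<in> P n \<Longrightarrow> u * v \<in> P (Suc n)"
  using P_mult[of u 1 v n] by simp

lemma P_mult_Suc: "u \<in> P n \<Longrightarrow> v \<in> P 1 \<Longrightarrow> u * v \<in> P (Suc n)"
  using P_mult[of u n v 1] by simp

lemma power_in_P: "x \<in> A \<Longrightarrow> x ^ p \<in> P 1"
  unfolding P_def by (intro span_base CollectI exI[of _ "[x]"]) auto

lemma P_induct [consumes 1, case_names subspace power]:
  assumes "u \<in> P 1" "subspace {u. Q u}" "\<And>x. x \<in> A \<Longrightarrow> Q (x ^ p)"
  shows "Q u"
  using assms(1) unfolding P_def
  by (rule span_induct) (use assms(2,3) in \<open>auto simp: length_Suc_conv\<close>)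

lemma P_split_induct [consumes 1, case_names subspace mult]:
  assumes "u \<in> P (m + n)" "subspace {u. Q u}" "\<And>u v. u \<in> P m \<Longrightarrow> v \<in> P n \<Longrightarrow> Q (u * v)"
  shows "Q u"
  using assms(1) unfolding P_def
proof (rule span_induct)
  fix x assume "x \<in> {prod_list (map (\<lambda>x. x ^ p) xs) | xs. length xs = m + n \<and> set xs \<subseteq> A}"
  then obtain xs where xs: "x = prod_list (map (\<lambda>x. x ^ p) xs)" "length xs = m + n" "set xs \<subseteq> A"
    by blast
  define ys zs where "ys = take m xs" and "zs = drop m xs"
  have "x = prod_list (map (\<lambda>x. x ^ p) ys) * prod_list (map (\<lambda>x. x ^ p) zs)"
    by (metis append_take_drop_id map_append prod_list.append xs(1) ys_def zs_def)
  moreover have "prod_list (map (\<lambda>x. x ^ p) ys) \<in> P m" "prod_list (map (\<lambda>x. x ^ p) zs) \<in> P n"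
    using xs set_take_subset[of m xs] set_drop_subset[of m xs]
    unfolding P_def ys_def zs_def by (auto intro!: span_base exI)
  ultimately show "Q x" using assms(3) by simp
qed (rule assms(2))

lemma P_0: "u \<in> P 0 \<Longrightarrow> \<exists>c. u = c *s 1"
proof -
  have "P 0 = span {1}" by (simp add: P_def)
  then show "u \<in> P 0 \<Longrightarrow> \<exists>c. u = c *s 1"
    by (auto simp: span_singleton)
qed

lemma power_in_A: "x \<in> A \<Longrightarrow> x ^ Suc n \<in> A"
  by (induction n) (auto intro: mult_A)

lemma P_1_subset_A: "u \<in> P 1 \<Longrightarrow> u \<in> A"
proof (induction rule: P_induct)
  case (power x)
  then show ?case using power_in_A[of x "p - 1"] p_gt_2 by simp
qed (simp add: subspace_A)

lemma P_Suc_subset_A: "u \<in> P (Suc n) \<Longrightarrow> u \<in> A"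
proof (induction n arbitrary: u)
  case (Suc n)
  then have "u \<in> P (1 + Suc n)" by simp
  then show ?case
    by (rule P_split_induct) (use Suc.IH P_1_subset_A mult_A subspace_A in auto)
qed (use P_1_subset_A in simp)

text \<open>The derivative is the coefficient of \<open>t\<close> in
  \<open>(x + t *s y) ^ p\<close>, whose values and top coefficient \<open>y ^ p\<close> lie in
  \<open>P 1\<close>.\<close>

lemma power_deriv_in_P:
  assumes "x \<in> A" "y \<in> A"
  shows "power_deriv x y p \<in> P 1"
proof -
  have "binomial_words x y p 1 \<in> P 1"
  proof (rule coeffs_in_subspace_char)
    show "(\<Sum>k\<le>p. t ^ k *s binomial_words x y p k) \<in> P 1" for t
      unfolding power_add_scale[symmetric]
      using assms subspace_A by (intro power_in_P subspace_add subspace_scale)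
    show "binomial_words x y p p \<in> P 1" using assms by (simp add: power_in_P del: One_nat_def)
  qed (use p_gt_2 subspace_P in auto)
  then show ?thesis by (simp only: binomial_words_1)
qed

text \<open>The identity \<open>h(x, y) x = h(x, y x)\<close> is polarised in \<open>x\<close>: the coefficient of \<open>t\<close> in
  \<open>h(x + t v, y) (x + t v)\<close> is \<open>h(x, y) v + s x\<close>, where \<open>s\<close> is symmetric in \<open>y\<close> and \<open>v\<close>.\<close>

lemma power_deriv_exchange:
  assumes "x \<in> A" "y \<in> A" "z \<in> A"
  shows "power_deriv x y p * z - power_deriv x z p * y \<in> P 1"
proof -
  have *: "power_deriv x y p * v + power_deriv_words x v y p 1 * x \<in> P 1" if "y \<in> A" "v \<in> A" for y v
  proof -
    \<comment> \<open>The coefficient of \<open>t ^ k\<close> in the product of h(x + t v, y) and x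
      + t v.\<close>
    define c where "c k = power_deriv_words x v y p k * x
      + (if k = 0 then 0 else power_deriv_words x v y p (k - 1) * v)" for k
    have "c 1 \<in> P 1"
    proof (rule coeffs_in_subspace_char)
      fix t
      have "(\<Sum>k\<le>p. t ^ k *s c k) = (\<Sum>k\<le>p. t ^ k *s power_deriv_words x v y p k) * x
        + (\<Sum>k\<le>p. t ^ k *s (if k = 0 then 0 else power_deriv_words x v y p (k - 1) * v))"
        by (simp add: c_def scale_right_distrib sum.distrib sum_distrib_right scale_mult_left)
      also have "(\<Sum>k\<le>p. t ^ k *s (if k = 0 then 0 else power_deriv_words x v y p (k - 1) * v))
        = (\<Sum>k\<le>Suc p. t ^ k *s (if k = 0 then 0 else power_deriv_words x v y p (k - 1) * v))"
        by (simp add: power_deriv_words_ge)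
      also have "\<dots> = (\<Sum>k\<le>p. t ^ k *s power_deriv_words x v y p k) * (t *s v)"
        by (simp add: sum.atMost_Suc_shift sum_distrib_right scale_mult_left scale_mult_right scale_sum_right
            del: sum.atMost_Suc)
      finally have "(\<Sum>k\<le>p. t ^ k *s c k) = power_deriv (x + t *s v) y p * (x + t *s v)"
        unfolding power_deriv_add_scale distrib_left .
      also have "\<dots> = power_deriv (x + t *s v) (y * (x + t *s v)) p"
        by (simp only: power_deriv_mult_right)
      also have "\<dots> \<in> P 1"
        using assms that subspace_A
        by (intro power_deriv_in_P mult_A subspace_add subspace_scale)
      finally show "(\<Sum>k\<le>p. t ^ k *s c k) \<in> P 1" .
    next
      \<comment> \<open>Only the second summand survives at \<open>t ^ p\<close>; it is h(v, y) v =
        h(v, y v).\<close>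
      have "c p = power_deriv v (y * v) p"
        using power_deriv_words_last[of x v y "p - 1"] p_gt_2
        by (simp add: c_def power_deriv_words_ge power_deriv_mult_right)
      then show "c p \<in> P 1" using that by (simp add: power_deriv_in_P mult_A del: One_nat_def)
    qed (use p_gt_2 subspace_P in auto)
    then show ?thesis by (simp add: c_def add.commute)
  qed
  show ?thesis
    \<comment> \<open>The symmetric second-derivative terms cancel between the two
      instances.\<close>
    using subspace_diff[OF subspace_P *[of y z] *[of z y]] assms
    by (simp only: power_deriv_words_1_commute[of x y z] add_diff_cancel_right)
qed

section \<open>Additivity defects and commutators of p-th powers\<close>

definition W :: "'a set" where
  "W = span {power_deriv x y p | x y. x \<in> A \<and> y \<in> A}"

lemma W_subset_P: "w \<in> W \<Longrightarrow> w \<in> P 1"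
  unfolding W_def by (erule span_induct) (auto simp: power_deriv_in_P subspace_P simp del: One_nat_def)

text \<open>For 0 < k < p the k-th term of the expansion, multiplied by k, is the coefficient of
  t^(k-1) in h(x + t y, y), and k is invertible in the field.\<close>

lemma power_add_in_W:
  assumes "x \<in> A" "y \<in> A"
  shows "(x + y) ^ p - x ^ p - y ^ p \<in> W"
proof -
  have words: "power_deriv_words x y y p k \<in> W" if "k \<le> p" for k
  proof (rule coeffs_in_subspace_char[OF _ _ _ that])
    show "(\<Sum>k\<le>p. t ^ k *s power_deriv_words x y y p k) \<in> W" for t
      unfolding power_deriv_add_scale[symmetric] W_def using assms subspace_A
      by (auto intro!: span_base intro: subspace_add subspace_scale)
    show "subspace W" "power_deriv_words x y y p p \<in> W"
      by (simp_all add: W_def power_deriv_words_ge span_zero)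
  qed
  have "binomial_words x y p k \<in> W" if "k \<in> {1..<p}" for k
  proof -
    have nz: "(of_nat k :: 'k) \<noteq> 0"
      using that by (auto simp: of_nat_eq_0_iff_char_dvd CHAR_eq dest: dvd_imp_le)
    have "of_nat k *s binomial_words x y p k \<in> W"
      using words[of "k - 1"] that by (cases k) (simp_all add: power_deriv_words_same flip: of_nat_mult_eq_scale del: of_nat_Suc)
    then have "inverse (of_nat k) *s of_nat k *s binomial_words x y p k \<in> W"
      unfolding W_def by (rule span_scale)
    then show ?thesis using nz by simp
  qed
  then have "(\<Sum>k\<in>{1..<p}. binomial_words x y p k) \<in> W"
    unfolding W_def by (rule span_sum)
  moreover have "(x + y) ^ p = (\<Sum>k\<le>p. binomial_words x y p k)"
    using power_add_scale[of x 1 y p] by simp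
  moreover have "{..p} = insert 0 (insert p {1..<p})" using p_gt_2 by auto
  ultimately show ?thesis using p_gt_2 by simp
qed

text \<open>For a single power, x^p b - b x^p = h(x, x b - b x) lies in \<open>P 1\<close>; the
  Leibniz rule for commutators does the rest.\<close>

lemma P_commutator: "u \<in> P n \<Longrightarrow> b \<in> A \<Longrightarrow> u * b - b * u \<in> P n"
proof (induction n arbitrary: u)
  case 0
  then show ?case
    using P_0[of u] subspace_0[OF subspace_P] by (auto simp: scale_mult_left scale_mult_right)
next
  case (Suc n)
  have 1: "v * b - b * v \<in> P 1" if "v \<in> P 1" for v
    using that
  proof (induction rule: P_induct)
    case (power x)
    have "power_deriv x (x * b - b * x) p \<in> P 1"
      using power Suc.prems(2) by (intro power_deriv_in_P subspace_diff[OF subspace_A] mult_A)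
    then show ?case by (simp only: power_deriv_commutator)
  qed (intro subspace_mult_preimage subspace_P)
  from Suc.prems have "u \<in> P (1 + n)" by simp
  then show ?case
  proof (induction rule: P_split_induct)
    case (mult u v)
    have "u * v * b - b * (u * v) = u * (v * b - b * v) + (u * b - b * u) * v"
      by (simp add: algebra_simps)
    then show ?case
      using Suc.IH[OF mult(2)] Suc.prems(2) 1[OF mult(1)] mult
      by (simp add: P_Suc_mult subspace_add[OF subspace_P])
  qed (intro subspace_mult_preimage subspace_P)
qed

end

section \<open>The ideal of negligible elements\<close>

locale char_p_algebra_shift = char_p_algebra scale p A
  for scale :: "'k::field \<Rightarrow> 'a::ring_1 \<Rightarrow> 'a" (infixr "*s" 75) and p A +
  fixes a d :: nat
  assumes d_pos: "0 < d"
begin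

text \<open>In the application \<open>Suc a\<close> and \<open>Suc a + d\<close> are the two least
  indices, so \<open>V\<close> is contained in every T-space considered.\<close>

definition V :: "'a set" where "V = span (P (Suc a) \<union> P (Suc a + d))"

text \<open>The largest two-sided ideal (with respect to \<open>A\<close> with unit adjoined) such that
  \<open>P a * R\<close> is contained in \<open>V\<close>.\<close>

definition R :: "'a set" where
  "R = {r. \<forall>w\<in>P a. \<forall>q\<in>insert 1 A. \<forall>s\<in>insert 1 A. w * q * r * s \<in> V}"

text \<open>Stands for \<open>P n\<close> modulo \<open>R\<close>: multiplication by
  \<open>P a\<close> on the left sends it into \<open>P (a + n)\<close> plus
  \<open>V\<close>.\<close>

definition Q :: "nat \<Rightarrow> 'a set" where "Q n = span (P n \<union> R)"

lemma subspace_V: "subspace V" by (simp add: V_def)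

lemma subspace_Q: "subspace (Q n)" by (simp add: Q_def)

lemma P_subset_V: "u \<in> P (Suc a) \<Longrightarrow> u \<in> V" "u \<in> P (Suc a + d) \<Longrightarrow> u \<in> V"
  by (simp_all add: V_def span_base)

lemma P_subset_Q: "u \<in> P n \<Longrightarrow> u \<in> Q n"
  by (simp add: Q_def span_base)

lemma R_subset_Q: "u \<in> R \<Longrightarrow> u \<in> Q n"
  by (simp add: Q_def span_base)

lemma V_commutator: "u \<in> V \<Longrightarrow> b \<in> A \<Longrightarrow> u * b - b * u \<in> V"
  unfolding V_def
  by (erule span_induct[OF _ subspace_mult_preimage(3)]) (auto intro: span_base P_commutator)

lemma subspace_R: "subspace R"
  unfolding R_def subspace_def
  using subspace_V
  by (auto simp: distrib_left distrib_right scale_mult_left scale_mult_right subspace_0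
      intro!: subspace_add subspace_scale)

lemma R_mult_A: "r \<in> R \<Longrightarrow> b \<in> insert 1 A \<Longrightarrow> b * r \<in> R" "r \<in> R \<Longrightarrow> b \<in> insert 1 A \<Longrightarrow> r * b \<in> R"
proof -
  have 1: "x * y \<in> insert 1 A" if "x \<in> insert 1 A" "y \<in> insert 1 A" for x y
    using that mult_A by auto
  show "b * r \<in> R" if "r \<in> R" "b \<in> insert 1 A"
    unfolding R_def
  proof (intro CollectI ballI)
    fix w q s assume "w \<in> P a" "q \<in> insert 1 A" "s \<in> insert 1 A"
    then have "w * (q * b) * r * s \<in> V"
      using that 1[of q b] by (simp only: R_def mem_Collect_eq)
    then show "w * q * (b * r) * s \<in> V" by (simp only: mult.assoc)
  qed
  show "r * b \<in> R" if "r \<in> R" "b \<in> insert 1 A"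
    unfolding R_def
  proof (intro CollectI ballI)
    fix w q s assume "w \<in> P a" "q \<in> insert 1 A" "s \<in> insert 1 A"
    then have "w * q * r * (b * s) \<in> V"
      using that 1[of b s] by (simp only: R_def mem_Collect_eq) 
    then show "w * q * (r * b) * s \<in> V" by (simp only: mult.assoc)
  qed
qed

lemma P_cases: "u \<in> P n \<Longrightarrow> u \<in> A \<or> (\<exists>c. u = c *s 1)"
  by (cases n) (auto dest: P_0 P_Suc_subset_A)

lemma R_mult_P: "r \<in> R \<Longrightarrow> u \<in> P n \<Longrightarrow> u * r \<in> R" "r \<in> R \<Longrightarrow> u \<in> P n \<Longrightarrow> r * u \<in> R"
  using P_cases[of u n] R_mult_A[of r u] subspace_scale[OF subspace_R]
  by (auto simp: scale_mult_left scale_mult_right)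

lemma R_mult_P_between: "r \<in> R \<Longrightarrow> u \<in> P m \<Longrightarrow> v \<in> P n \<Longrightarrow> u * r * v \<in> R"
  by (intro R_mult_P)

lemma Q_mult_P: "q \<in> Q n \<Longrightarrow> u \<in> P m \<Longrightarrow> u * q \<in> Q (m + n)" "q \<in> Q n \<Longrightarrow> u \<in> P m \<Longrightarrow> q * u \<in> Q (n + m)"
proof -
  show "u * q \<in> Q (m + n)" if "q \<in> Q n" "u \<in> P m"
    using that(1) unfolding Q_def[of n]
    by (rule span_induct[OF _ subspace_mult_preimage(1)[OF subspace_Q]])
       (use that in \<open>auto intro: P_subset_Q R_subset_Q P_mult R_mult_P\<close>)
  show "q * u \<in> Q (n + m)" if "q \<in> Q n" "u \<in> P m"
    using that(1) unfolding Q_def[of n]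
    by (rule span_induct[OF _ subspace_mult_preimage(2)[OF subspace_Q]])
       (use that in \<open>auto intro: P_subset_Q R_subset_Q P_mult R_mult_P\<close>)
qed

lemma P_d_subset_A: "v \<in> P d \<Longrightarrow> v \<in> A"
  using d_pos P_Suc_subset_A[of v "d - 1"] by simp

text \<open>Modulo \<open>P (Suc a)\<close>, the exchange identity turns \<open>w * h(x,v) * s\<close> into
  \<open>w * h(x,s) * v\<close>, which lies in \<open>P (Suc a + d)\<close>.\<close>

lemma power_deriv_in_R:
  assumes "x \<in> A" "v \<in> P d"
  shows "power_deriv x v p \<in> R"
proof -
  let ?g = "power_deriv x v p"
  have vA: "v \<in> A" using assms P_d_subset_A by blast
  have g: "?g \<in> P 1" using assms vA by (simp add: power_deriv_in_P del: One_nat_def)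
  have *: "w * ?g \<in> V" if "w \<in> P a" for w
    using P_subset_V(1) P_mult_Suc that g by blast
  have 1: "w * ?g * s \<in> V" if "w \<in> P a" "s \<in> insert 1 A" for w s
  proof (cases "s = 1")
    case False
    with that have s: "s \<in> A" by simp
    have "w * (?g * s - power_deriv x s p * v) \<in> V"
      using P_mult_Suc power_deriv_exchange assms(1) s vA that(1) P_subset_V(1) by blast
    moreover have "w * power_deriv x s p * v \<in> V"
      using P_mult[OF P_mult_Suc[OF that(1) power_deriv_in_P[OF assms(1) s]] assms(2)] P_subset_V(2) by simp
    ultimately have "w * (?g * s - power_deriv x s p * v) + w * power_deriv x s p * v \<in> V"
      by (rule subspace_add[OF subspace_V])
    then show ?thesis by (simp add: algebra_simps)
  qed (use * that in simp)
  have 2: "w * q * ?g \<in> V" if "w \<in> P a" "q \<in> insert 1 A" for w q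
  proof (cases "q = 1")
    case False
    with that have q: "q \<in> A" by simp
    \<comment> \<open>\<open>q\<close> moves to the right of the derivative; the commutator stays in
      \<open>P 1\<close>.\<close>
    have "w * q * ?g = w * ?g * q - w * (?g * q - q * ?g)"
      by (simp add: algebra_simps)
    also have "\<dots> \<in> V"
      using 1[OF that(1), of q] q P_subset_V(1)[OF P_mult_Suc[OF that(1) P_commutator[OF g q]]]
      by (intro subspace_diff[OF subspace_V]) auto
    finally show ?thesis .
  qed (use * that in simp)
  have 3: "w * q * ?g * s \<in> V" if "w \<in> P a" "q \<in> insert 1 A" "s \<in> insert 1 A" for w q s
  proof (cases "s = 1")
    case False
    with that have s: "s \<in> A" by simp
    then have sq: "s * q \<in> insert 1 A" using that mult_A by auto
    \<comment> \<open>\<open>s\<close> is carried around to the left of \<open>q\<close>: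
      \<open>V\<close> is stable under commutators, and \<open>w * s - s * w\<close> is again in
      \<open>P a\<close>, so the previous claim covers the other terms.\<close>
    have "w * q * ?g * s = ((w * q * ?g) * s - s * (w * q * ?g)) - (w * s - s * w) * q * ?g + w * (s * q) * ?g"
      by (simp add: algebra_simps)
    also have "\<dots> \<in> V"
      using V_commutator[OF 2[OF that(1,2)] s] 2[OF P_commutator[OF that(1) s] that(2)] 2[OF that(1) sq]
      by (metis subspace_diff[OF subspace_V] subspace_add[OF subspace_V])
    finally show ?thesis .
  qed (use 2 that in simp)
  then show ?thesis unfolding R_def by blast
qed

section \<open>Commutation and collapse of factors modulo the ideal\<close>

text \<open>x^p v - v x^p = h(x, x v - v x) = x h(x,v) - h(x,v) x, and h(x,v) is in the ideal
  \<open>R\<close>.\<close>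

lemma P_1_commutes_P_d: 
  assumes "u \<in> P 1" "v \<in> P d"
  shows "u * v - v * u \<in> R"
  using assms(1)
proof (induction rule: P_induct)
  case (power x)
  have g: "power_deriv x v p \<in> R" using power assms(2) by (rule power_deriv_in_R)
  have "power_deriv x (x * v - v * x) p = x * power_deriv x v p - power_deriv x v p * x"
    by (simp only: power_deriv_diff power_deriv_mult_left power_deriv_mult_right)
  then show ?case
    using R_mult_A[OF g, of x] power
    by (simp only: power_deriv_commutator[symmetric]) (auto intro: subspace_diff[OF subspace_R])
qed (intro subspace_mult_preimage subspace_R)

text \<open>By exchange, h(x,y) v equals h(x,v) y up to \<open>P 1\<close>, and h(x,v) is in
  \<open>R\<close>.\<close>

lemma W_mult_P_d:
  assumes "w \<in> W" "v \<in> P d"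
  shows "w * v \<in> Q 1"
  using assms(1) unfolding W_def
proof (rule span_induct[OF _ subspace_mult_preimage(2)[OF subspace_Q]])
  fix h assume "h \<in> {power_deriv x y p | x y. x \<in> A \<and> y \<in> A}"
  then obtain x y where h: "h = power_deriv x y p" "x \<in> A" "y \<in> A" by blast
  have "h * v = (h * v - power_deriv x v p * y) + power_deriv x v p * y" by simp
  also have "\<dots> \<in> Q 1"
    unfolding h(1)
    using power_deriv_exchange[OF h(2,3) P_d_subset_A[OF assms(2)]]
      R_mult_A(2)[OF power_deriv_in_R[OF h(2) assms(2)], of y] h(3)
    by (intro subspace_add[OF subspace_Q]) (auto intro: P_subset_Q R_subset_Q)
  finally show "h * v \<in> Q 1" .
qed

text \<open>The factors of \<open>u\<close> are carried to the far end one at a time, each past the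
  \<open>d\<close> other factors.\<close>

lemma P_rotate:
  assumes "u \<in> P i" "w \<in> P j" "i + j = Suc d" "0 < j"
  shows "u * w - w * u \<in> R"
  using assms
proof (induction i arbitrary: u w j)
  case 0
  then show ?case using P_0[of u] subspace_0[OF subspace_R] by (auto simp: scale_mult_left scale_mult_right)
next
  case (Suc i)
  from Suc.prems(1) have "u \<in> P (1 + i)" by simp
  then show ?case
  proof (induction rule: P_split_induct)
    case (mult u v)
    have "v * w \<in> P d" using P_mult[OF mult(2) Suc.prems(2)] Suc.prems(3) by simp
    then have "u * (v * w) - v * w * u \<in> R"
      using P_1_commutes_P_d mult(1) by blast
    moreover have "v * (w * u) - w * u * v \<in> R"
      by (rule Suc.IH[OF mult(2) P_mult_Suc[OF Suc.prems(2) mult(1)]]) (use Suc.prems in auto)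
    ultimately have "(u * (v * w) - v * w * u) + (v * (w * u) - w * u * v) \<in> R"
      by (rule subspace_add[OF subspace_R])
    then show ?case by (simp add: algebra_simps)
  qed (intro subspace_mult_preimage subspace_R)
qed

text \<open>For a product of \<open>d + 2\<close> elements of \<open>P 1\<close>, all cyclic rotations of windows of length
  \<open>d + 1\<close> are allowed. They generate the 3-cycles, and comparing a 3-cycle with the rotation of
  the window that contains the single factor \<open>x * z - z * x\<close> shows that twice this
  commutator annihilates \<open>P d\<close>.\<close>

lemma commutator_mult_P_d:
  assumes x: "x \<in> P 1" and z: "z \<in> P 1" and t: "t \<in> P d"
  shows "(x * z - z * x) * t \<in> R"
proof -
  note add = subspace_add[OF subspace_R] and diff = subspace_diff[OF subspace_R]
  define e where "e = d - 1"
  have d: "d = Suc e" using d_pos by (simp add: e_def)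
  have com: "u * v - v * u \<in> R" if "u \<in> P 1" "v \<in> P (Suc e)" for u v
    using P_1_commutes_P_d that d by simp
  have comm: "b * (u * v - v * u) \<in> R" "(u * v - v * u) * b \<in> R"
    if "u \<in> P 1" "v \<in> P (Suc e)" "b \<in> P 1" for u v b
    using R_mult_P com that by blast+
  have L: "b * s \<in> P (Suc e)" and L': "s * b \<in> P (Suc e)" if "b \<in> P 1" "s \<in> P e" for b s
    using that by (auto intro: P_Suc_mult P_mult_Suc)
  have rot: "x * z * y * s - y * z * s * x \<in> R"
    if "x \<in> P 1" "z \<in> P 1" "y \<in> P 1" "s \<in> P e" for x y z s
  proof -
    \<comment> \<open>The route is x z y s, x y s z, y s x z, y z s x; each move is a single factor
      passing a block from \<open>P d\<close>.\<close>
    have "(x * (y * s) - y * s * x) * z - y * (z * (s * x) - s * x * z) + x * (z * (y * s) - y * s * z) \<in> R"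
      using add[OF diff[OF comm(2)[of x "y * s" z] comm(1)[of z "s * x" y]] comm(1)[of z "y * s" x]] that L L'
      by blast
    then show ?thesis by (simp add: algebra_simps)
  qed
  have cyc: "x * z * y * s - y * x * z * s \<in> R"
    if "x \<in> P 1" "z \<in> P 1" "y \<in> P 1" "s \<in> P e" for x y z s
  proof -
    have "(x * z * y * s - y * z * s * x) - y * (x * (z * s) - z * s * x) \<in> R"
      using diff[OF rot comm(1)[of x "z * s" y]] that L by blast
    then show ?thesis by (simp add: algebra_simps)
  qed
  have swap: "x * z * y * s - z * x * s * y \<in> R"
    if "x \<in> P 1" "z \<in> P 1" "y \<in> P 1" "s \<in> P e" for x y z s
  proof -
    have "(x * z * y * s - y * z * s * x) + (y * (z * s) - z * s * y) * x - z * (x * (s * y) - s * y * x) \<in> R"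
      using diff[OF add[OF rot comm(2)[of y "z * s" x]] comm(1)[of x "s * y" z]] that L L' by blast
    then show ?thesis by (simp add: algebra_simps)
  qed
  let ?c = "x * z - z * x"
  have c: "?c \<in> P 1" using P_commutator x z P_1_subset_A by blast
  from t have "t \<in> P (1 + e)" by (simp add: d)
  then show ?thesis
  proof (induction rule: P_split_induct)
    case (mult y s)
    \<comment> \<open>With c = x z - z x, the \<open>cyc\<close> terms give c y s - y c s, the
      rotation of c gives y c s - c s y, and the \<open>swap\<close> terms give c y s + c s y. The
      total is 2 c y s.\<close>
    have "(x * z * y * s - y * x * z * s) - (z * x * y * s - y * z * x * s)
        + (y * (?c * s) - (?c * s) * y)
        + (x * z * y * s - z * x * s * y) - (z * x * y * s - x * z * s * y) \<in> R"
      by (rule diff[OF add[OF add[OF diff[OF cyc[OF x z mult] cyc[OF z x mult]]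
          com[OF mult(1) L[OF c mult(2)]]] swap[OF x z mult]] swap[OF z x mult]])
    then have "(2 :: 'a) * (?c * (y * s)) \<in> R"
      by (simp add: algebra_simps mult_2)
    then have "(2 :: 'k) *s (?c * (y * s)) \<in> R"
      using of_nat_mult_eq_scale[of 2 "?c * (y * s)"] by simp
    then have "inverse (2 :: 'k) *s (2 :: 'k) *s (?c * (y * s)) \<in> R"
      by (rule subspace_scale[OF subspace_R])
    then show ?case using two_neq_0 by simp
  qed (intro subspace_mult_preimage subspace_R)
qed

text \<open>If fewer than \<open>d\<close> factors stand on the right, the last \<open>d - j\<close>
  factors of \<open>u\<close> are rotated behind \<open>v\<close>; this window has
  \<open>d + 1\<close> factors, the commutator counting as one.\<close>

lemma commutator_between:
  assumes u: "u \<in> P i" and v: "v \<in> P j" and x: "x \<in> P 1" and z: "z \<in> P 1" and ij: "d \<le> i + j"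
  shows "u * (x * z - z * x) * v \<in> R"
proof -
  let ?c = "x * z - z * x"
  have c: "?c \<in> P 1" using P_commutator x z P_1_subset_A by blast
  show ?thesis
  proof (cases "d \<le> j")
    case True
    from v True have "v \<in> P (d + (j - d))" by simp
    then show ?thesis
    proof (induction rule: P_split_induct)
      case (mult v v')
      have "u * (?c * v) * v' \<in> R"
        using R_mult_P_between commutator_mult_P_d x z mult u by blast
      then show ?case by (simp only: mult.assoc)
    qed (intro subspace_mult_preimage subspace_R)
  next
    case False
    from u False ij have "u \<in> P ((i - (d - j)) + (d - j))" by simp
    then show ?thesis
    proof (induction rule: P_split_induct)
      case (mult u u')
      have "u' * (?c * v) - ?c * v * u' \<in> R"
        using P_rotate[OF mult(2) P_Suc_mult[OF c v]] False by simp
      moreover have "?c * (v * u') \<in> R"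
        using commutator_mult_P_d[OF x z] P_mult[OF v mult(2)] False by simp
      ultimately have "(u' * (?c * v) - ?c * v * u') + ?c * (v * u') \<in> R"
        by (rule subspace_add[OF subspace_R])
      then have "u' * ?c * v \<in> R" by (simp add: algebra_simps)
      then show ?case using R_mult_P(1) mult(1) by (metis mult.assoc)
    qed (use subspace_mult_preimage(2)[OF subspace_R, of "?c * v"] in \<open>simp add: mult.assoc\<close>)
  qed
qed

text \<open>As for commutators, \<open>d\<close> neighbours are gathered to the right of
  \<open>w\<close>; together with \<open>w\<close> they collapse to one factor of \<open>P 1\<close>
  modulo \<open>R\<close>.\<close>

lemma W_between:
  assumes u: "u \<in> P i" and v: "v \<in> P j" and w: "w \<in> W" and ij: "d \<le> i + j"
  shows "u * w * v \<in> Q (i + j + 1 - d)"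
proof (cases "d \<le> j")
  case True
  from v True have "v \<in> P (d + (j - d))" by simp
  then show ?thesis
  proof (induction rule: P_split_induct)
    case (mult v v')
    have "u * (w * v) * v' \<in> Q (i + 1 + (j - d))"
      using Q_mult_P W_mult_P_d w mult u by blast
    then show ?case using True by (simp add: mult.assoc Suc_diff_le)
  qed (intro subspace_mult_preimage subspace_Q)
next
  case False
  from u False ij have "u \<in> P ((i - (d - j)) + (d - j))" by simp
  then show ?thesis
  proof (induction rule: P_split_induct)
    case (mult u u')
    have "u' * (w * v) - w * v * u' \<in> R"
      using P_rotate[OF mult(2) P_Suc_mult[OF W_subset_P[OF w] v]] False by simp
    moreover have "w * (v * u') \<in> Q 1"
      using W_mult_P_d[OF w] P_mult[OF v mult(2)] False by simp
    ultimately have "(u' * (w * v) - w * v * u') + w * (v * u') \<in> Q 1"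
      using subspace_add[OF subspace_Q] R_subset_Q by blast
    then have "u' * (w * v) \<in> Q 1" by (simp add: algebra_simps)
    then have "u * (u' * (w * v)) \<in> Q (i - (d - j) + 1)"
      using Q_mult_P(1) mult(1) by blast
    moreover have "i - (d - j) + 1 = i + j + 1 - d" using False ij by simp
    ultimately show ?case by (simp only: mult.assoc)
  qed (use subspace_mult_preimage(2)[OF subspace_Q, of "w * v"] in \<open>simp add: mult.assoc\<close>)
qed

section \<open>Contraction of pairs of factors\<close>

text \<open>Each of the \<open>k\<close> pairs of factors is contracted by polarising
  \<open>((x + y)\<^sup>2) ^ p = (x + y) ^ p * (x + y) ^ p\<close>. The factor \<open>q\<close> collects squares
  \<open>z ^ p * z ^ p = (z\<^sup>2) ^ p\<close>, which count as two factors or as one.\<close>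

lemma contract_pairs:
  assumes "u \<in> P (2 * k)" "q \<in> P (e + m)" "q \<in> P (2 * e + m)" "k + e = d" "0 < m"
  shows "u * q \<in> Q (d + m)"
  using assms
proof (induction k arbitrary: u q e)
  case 0
  then show ?case
    using P_mult[of u 0 q "d + m"] by (auto intro: P_subset_Q)
next
  case (Suc k)
  note add = subspace_add[OF subspace_Q] and diff = subspace_diff[OF subspace_Q]
  have square: "v * (z ^ p * z ^ p) * q \<in> Q (d + m)" if "v \<in> P (2 * k)" "z \<in> A" for v z
  proof -
    have "(z * z) ^ p * q \<in> P (Suc (e + m))"
      using that Suc.prems by (intro P_Suc_mult power_in_P mult_A)
    moreover have "(z * z) ^ p = z ^ p * z ^ p" 
      by (metis mult_2 mult.commute power2_eq_square power_add power_mult)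
    moreover have "z ^ p * (z ^ p * q) \<in> P (Suc (Suc (2 * e + m)))"
      using that Suc.prems by (intro P_Suc_mult power_in_P)
    ultimately have "v * (z ^ p * z ^ p * q) \<in> Q (d + m)"
      \<comment> \<open>The square joins \<open>q\<close>: one more factor in the contracted count,
        two more in the full count, so \<open>e\<close> grows by one.\<close>
      using Suc.IH[OF that(1), of "z ^ p * z ^ p * q" "Suc e"] Suc.prems by (simp add: mult.assoc)
    then show ?thesis by (simp add: mult.assoc)
  qed
  have err: "v * w * b * q \<in> Q (d + m)" "v * b * w * q \<in> Q (d + m)"
    if "v \<in> P (2 * k)" "w \<in> W" "b \<in> P 1" for v w b
  proof -
    \<comment> \<open>Besides \<open>w\<close> there are \<open>2 * d + m - 1\<close> factors;
      \<open>d\<close> of them and \<open>w\<close> collapse to one, which leaves exactly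
      \<open>d + m\<close>.\<close>
    have num: "2 * k + Suc (2 * e + m) + 1 - d = d + m" "Suc (2 * k) + (2 * e + m) + 1 - d = d + m"
      using Suc.prems(4) by auto
    show "v * w * b * q \<in> Q (d + m)"
      using W_between[OF that(1) P_Suc_mult[OF that(3) Suc.prems(3)] that(2)] num Suc.prems
      by (simp add: mult.assoc)
    show "v * b * w * q \<in> Q (d + m)"
      using W_between[OF P_mult_Suc[OF that(1,3)] Suc.prems(3) that(2)] num Suc.prems
      by simp
  qed
  have pair: "v * (x ^ p * y ^ p) * q \<in> Q (d + m)" if v: "v \<in> P (2 * k)" and xy: "x \<in> A" "y \<in> A" for v x y
  proof -
    define X Y where "X = x ^ p" and "Y = y ^ p"
    have XY: "X \<in> P 1" "Y \<in> P 1" using xy by (auto simp: X_def Y_def power_in_P simp del: One_nat_def)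
    define w where "w = (x + y) ^ p - X - Y"
    have w: "w \<in> W" using power_add_in_W[OF xy] by (simp add: w_def X_def Y_def)
    have Z: "(x + y) ^ p = X + Y + w" by (simp add: w_def)
    \<comment> \<open>The commutator is surrounded by \<open>2 * d - 2 + m\<close> factors, at least
      \<open>d\<close> because \<open>0 < m\<close>.\<close>
    have s: "v * (X * Y - Y * X) * q \<in> Q (d + m)"
      using commutator_between[OF v Suc.prems(3) XY] Suc.prems R_subset_Q by auto
    \<comment> \<open>Removing the squares and all terms containing \<open>w\<close> leaves X Y + Y
      X; adding the commutator gives 2 X Y.\<close>
    have "v * ((X + Y + w) * (X + Y + w)) * q - v * (X * X) * q - v * (Y * Y) * q
        - (v * w * X * q + v * w * Y * q + v * X * w * q + v * Y * w * q + v * w * w * q)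
        + v * (X * Y - Y * X) * q \<in> Q (d + m)"
      using square[OF v subspace_add[OF subspace_A xy]] square[OF v xy(1)] square[OF v xy(2)] s
        err[OF v w XY(1)] err[OF v w XY(2)] err[OF v w W_subset_P[OF w]]
      unfolding Z X_def[symmetric] Y_def[symmetric]
      by (intro add diff)
    then have "(2 :: 'a) * (v * (X * Y) * q) \<in> Q (d + m)"
      by (simp add: algebra_simps mult_2)
    then have "(2 :: 'k) *s (v * (X * Y) * q) \<in> Q (d + m)"
      using of_nat_mult_eq_scale[of 2 "v * (X * Y) * q"] by simp
    then have "inverse (2 :: 'k) *s (2 :: 'k) *s (v * (X * Y) * q) \<in> Q (d + m)"
      by (rule subspace_scale[OF subspace_Q])
    then show ?thesis using two_neq_0 by (simp add: X_def Y_def)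
  qed
  from Suc.prems(1) have "u \<in> P (2 * k + 2)" by (simp add: algebra_simps)
  then show ?case
  proof (induction rule: P_split_induct)
    case (mult v b)
    then have "b \<in> P (1 + 1)" by (simp only: one_add_one)
    then show ?case
    proof (induction rule: P_split_induct)
      case (mult b c)
      from mult(1) show ?case
      proof (induction rule: P_induct)
        case (power x)
        from mult(2) show ?case
        proof (induction rule: P_induct)
          case (power y)
          then show ?case using pair \<open>v \<in> P (2 * k)\<close> \<open>x \<in> A\<close> by simp
        qed (auto simp: subspace_def distrib_left distrib_right scale_mult_left scale_mult_right
            intro: add subspace_scale[OF subspace_Q] subspace_0[OF subspace_Q])
      qed (auto simp: subspace_def distrib_left distrib_right scale_mult_left scale_mult_right
            intro: add subspace_scale[OF subspace_Q] subspace_0[OF subspace_Q])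
    qed (auto simp: subspace_def distrib_left distrib_right scale_mult_left scale_mult_right
            intro: add subspace_scale[OF subspace_Q] subspace_0[OF subspace_Q])
  qed (intro subspace_mult_preimage subspace_Q)
qed

text \<open>The first \<open>a\<close> factors send \<open>R\<close> into \<open>V\<close>, the next
  \<open>2 * d\<close> contract in pairs, and the last \<open>m > 0\<close> form the initial
  \<open>q\<close>.\<close>

theorem P_reduce:
  assumes "Suc a + 2 * d \<le> n" "u \<in> P n"
  shows "u \<in> span (P (n - d) \<union> P (Suc a) \<union> P (Suc a + d))"
proof -
  let ?S = "span (P (n - d) \<union> P (Suc a) \<union> P (Suc a + d))"
  define m where "m = n - a - 2 * d"
  have n: "n = a + (2 * d + m)" "n - d = a + (d + m)" and m: "0 < m" using assms(1) by (auto simp: m_def)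
  have VS: "V \<subseteq> ?S" unfolding V_def by (intro span_mono) auto
  from assms(2) have "u \<in> P (a + (2 * d + m))" by (simp add: n)
  then show ?thesis
  proof (induction rule: P_split_induct)
    case (mult w u)
    have "u \<in> Q (d + m)"
      using mult(2)
    proof (induction rule: P_split_induct)
      case (mult u q)
      then show ?case using contract_pairs[of u d q 0 m] m by simp
    qed (simp add: subspace_Q)
    then show ?case
      unfolding Q_def
    proof (rule span_induct[OF _ subspace_mult_preimage(1)[OF subspace_span]])
      fix r assume "r \<in> P (d + m) \<union> R"
      then show "w * r \<in> ?S"
      proof
        assume "r \<in> P (d + m)"
        then show ?thesis using P_mult[OF mult(1)] by (auto simp: n(2) intro!: span_base simp del: One_nat_def)
      next
        assume "r \<in> R"
        then have "w * 1 * r * 1 \<in> V" using mult(1) unfolding R_def by blast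
        then show ?thesis using VS by auto
      qed
    qed
  qed simp
qed

end

section \<open>Passage to the free algebra\<close>

lemma ncpoly_eq_sum_single:
  "f = (\<Sum>u\<in>Poly_Mapping.keys f. Poly_Mapping.single u (Poly_Mapping.lookup f u))"
proof (rule poly_mapping_eqI)
  fix k
  have "Poly_Mapping.lookup (\<Sum>u\<in>Poly_Mapping.keys f. Poly_Mapping.single u (Poly_Mapping.lookup f u)) k
    = (\<Sum>u\<in>Poly_Mapping.keys f. if u = k then Poly_Mapping.lookup f k else 0)"
    by (auto simp: lookup_sum lookup_single when_def intro!: sum.cong)
  also have "\<dots> = Poly_Mapping.lookup f k" by (simp add: in_keys_iff)
  finally show "Poly_Mapping.lookup f k = Poly_Mapping.lookup
    (\<Sum>u\<in>Poly_Mapping.keys f. Poly_Mapping.single u (Poly_Mapping.lookup f u)) k" by simp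
qed

lemma nc_mult_eq_times: "nc_mult f g = f * g"
proof -
  have "f * g = (\<Sum>u\<in>Poly_Mapping.keys f. Poly_Mapping.single u (Poly_Mapping.lookup f u))
      * (\<Sum>v\<in>Poly_Mapping.keys g. Poly_Mapping.single v (Poly_Mapping.lookup g v))"
    using ncpoly_eq_sum_single by metis
  then show ?thesis
    by (simp add: nc_mult_def sum_product mult_single plus_list_def)
qed

text \<open>Here \<open>0\<close> is the empty word, so \<open>single 0 c\<close> is the constant
  \<open>c\<close>.\<close>

lemma nc_smult_eq_times: "nc_smult c f = Poly_Mapping.single 0 c * f"
  by (simp add: nc_smult_def mult_map_scale_conv_mult)

lemma single_0_commute:
  fixes f :: "'k::field ncpoly"
  shows "Poly_Mapping.single 0 c * f = f * Poly_Mapping.single 0 c"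
proof -
  have "Poly_Mapping.single 0 c * (\<Sum>u\<in>Poly_Mapping.keys f. Poly_Mapping.single u (Poly_Mapping.lookup f u))
    = (\<Sum>u\<in>Poly_Mapping.keys f. Poly_Mapping.single u (Poly_Mapping.lookup f u)) * Poly_Mapping.single 0 c"
    by (simp add: sum_distrib_left sum_distrib_right mult_single mult.commute)
  then show ?thesis using ncpoly_eq_sum_single by metis
qed

lemma free0_mult: "f \<in> free0 \<Longrightarrow> g \<in> free0 \<Longrightarrow> f * g \<in> free0"
proof -
  assume f: "f \<in> free0" and "g \<in> free0"
  have "[] \<notin> Poly_Mapping.keys (f * g)"
  proof
    assume "[] \<in> Poly_Mapping.keys (f * g)"
    then obtain u v where "[] = u + v" "u \<in> Poly_Mapping.keys f"
      using keys_mult[of f g] by blast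
    then have "[] \<in> Poly_Mapping.keys f" by (simp add: plus_list_def)
    with f show False by (simp add: free0_def in_keys_iff)
  qed
  then show ?thesis by (simp add: free0_def in_keys_iff)
qed

lemma vector_space_nc_smult: "vector_space nc_smult"
  by unfold_locales
    (simp_all add: nc_smult_eq_times distrib_left distrib_right single_add mult_single
      flip: mult.assoc)

lemma char_p_algebra_free0:
  assumes "prime p" "p > 2" "CHAR('k::field) = p"
  shows "char_p_algebra (nc_smult :: 'k \<Rightarrow> _) p free0"
proof -
  interpret vector_space "nc_smult :: 'k \<Rightarrow> _" by (rule vector_space_nc_smult)
  show ?thesis
  proof
    show "nc_smult c x * y = nc_smult c (x * y)" for c :: 'k and x y
      by (simp add: nc_smult_eq_times mult.assoc)
    show "x * nc_smult c y = nc_smult c (x * y)" for c :: 'k and x y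
      by (simp add: nc_smult_eq_times single_0_commute[of c x] flip: mult.assoc)
    show "subspace free0"
      using free0_mult by (auto simp: subspace_def free0_def lookup_add nc_smult_def Poly_Mapping.map.rep_eq when_def)
  qed (use assms free0_mult in auto)
qed

text \<open>The empty word is excluded: there \<open>word_eval\<close> is 0, while the empty product
  is 1.\<close>

lemma word_eval_eq_prod_list: "w \<noteq> [] \<Longrightarrow> word_eval \<sigma> w = prod_list (map \<sigma> w)"
  by (induction \<sigma> w rule: word_eval.induct) (auto simp: nc_mult_eq_times)

lemma prod_list_replicate: "prod_list (replicate n x) = x ^ n"
  by (induction n) auto

lemma prod_list_pow_word:
  "prod_list (map \<sigma> (concat (map (\<lambda>j. replicate p j) js))) = prod_list (map (\<lambda>j. \<sigma> j ^ p) js)"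
  by (induction js) (auto simp: prod_list_replicate)

lemma nc_subst_pow_mono:
  assumes "0 < p" "0 < i"
  shows "nc_subst \<sigma> (pow_mono p i) = prod_list (map (\<lambda>j. \<sigma> j ^ p) [1..<i+1])"
proof -
  define w where "w = concat (map (\<lambda>j. replicate p j) [1..<i+1])"
  have "w \<noteq> []" using assms by (auto simp: w_def)
  then have "nc_subst \<sigma> (pow_mono p i) = prod_list (map \<sigma> w)"
    by (simp only: nc_subst_def pow_mono_def w_def[symmetric]) (simp add: nc_smult_eq_times word_eval_eq_prod_list)
  then show ?thesis by (simp only: w_def prod_list_pow_word)
qed

lemma single_word: "Poly_Mapping.single w (1 :: 'k::field) = prod_list (map (\<lambda>i. Poly_Mapping.single [i] 1) w)"
proof (induction w)
  case Nil
  show ?case by (simp add: one_poly_mapping.abs_eq single.abs_eq zero_list_def when_def eq_commute)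
next
  case (Cons i w)
  then show ?case by (simp add: mult_single plus_list_def flip: Cons)
qed

section \<open>Choice of the finite basis\<close>

theorem theorem4p1:
  fixes p :: nat and I :: "nat set"
  assumes "prime p" and "p > 2" and "CHAR('k::field) = p"
    and "0 \<notin> I"
    and "infinite I \<or> card I \<ge> 2"
  shows "\<exists>B :: 'k ncpoly set. finite B \<and> B \<subseteq> free0
           \<and> T_span B = T_span ((\<lambda>i. pow_mono p i :: 'k ncpoly) ` I)
           \<and> card B \<le> (LEAST i. i \<in> I \<and> i > (LEAST i. i \<in> I)) - (LEAST i. i \<in> I) + 1"
proof -
  interpret char_p_algebra "nc_smult :: 'k \<Rightarrow> 'k ncpoly \<Rightarrow> 'k ncpoly" p free0
    using assms(1-3) by (rule char_p_algebra_free0)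
  define a where "a = (LEAST i. i \<in> I)"
  define b where "b = (LEAST i. i \<in> I \<and> i > a)"
  have "I \<noteq> {}" using assms(5) by auto
  then have a: "a \<in> I" unfolding a_def by (auto intro: LeastI)
  have a_le: "a \<le> i" if "i \<in> I" for i unfolding a_def using that by (rule Least_le)
  have "\<not> I \<subseteq> {a}"
    using assms(5) card_mono[of "{a}" I] by (auto dest: finite_subset)
  then obtain i where "i \<in> I \<and> i > a" using a_le by (force simp: le_less)
  then have b: "b \<in> I" "a < b" unfolding b_def by (metis (mono_tags, lifting) LeastI)+
  have b_le: "b \<le> i" if "i \<in> I" "i \<noteq> a" for i
    unfolding b_def using that a_le[of i] by (intro Least_le) auto
  define d where "d = b - a"
  have d: "0 < d" "b = a + d" using b by (auto simp: d_def)
  have "0 < a" using a assms(4) by (cases a) auto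
  \<comment> \<open>The locale counts from \<open>Suc a\<close>, hence the shift by one.\<close>
  interpret char_p_algebra_shift "nc_smult :: 'k \<Rightarrow> 'k ncpoly \<Rightarrow> 'k ncpoly" p free0 "a - 1" d
    by unfold_locales (rule d)
  define m where "m r = (LEAST i. i \<in> I \<and> i mod d = r)" for r
  \<comment> \<open>\<open>a\<close> is already the minimum of its residue class; \<open>b\<close>
    lies in the same class and is added because the reduction needs both. This gives at most
    \<open>d + 1\<close> indices.\<close>
  define T where "T = insert b (m ` ((\<lambda>i. i mod d) ` I))"
  have m: "m (i mod d) \<in> I" "m (i mod d) mod d = i mod d" "m (i mod d) \<le> i" if "i \<in> I" for i
    using LeastI[of "\<lambda>j. j \<in> I \<and> j mod d = i mod d" i] Least_le[of "\<lambda>j. j \<in> I \<and> j mod d = i mod d" i] that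
    by (auto simp: m_def)
  have residues: "(\<lambda>i. i mod d) ` I \<subseteq> {..<d}" using d by auto
  then have fin: "finite ((\<lambda>i. i mod d) ` I)" by (rule finite_subset) simp
  have "card T \<le> Suc (card (m ` ((\<lambda>i. i mod d) ` I)))"
    unfolding T_def by (rule card_insert_le_m1) auto
  also have "card (m ` ((\<lambda>i. i mod d) ` I)) \<le> card {..<d}"
    using card_image_le[OF fin] card_mono[OF _ residues] by (metis finite_lessThan le_trans)
  finally have card_T: "card T \<le> d + 1" by simp
  have T: "finite T" "T \<subseteq> I"
  proof -
    show "finite T" unfolding T_def by (rule finite.insertI[OF finite_imageI[OF fin]])
    show "T \<subseteq> I"
    proof
      fix x assume "x \<in> T"
      then consider "x = b" | i where "i \<in> I" "x = m (i mod d)" unfolding T_def by blast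
      then show "x \<in> I" by cases (use b(1) m(1) in simp_all)
    qed
  qed
  have "m (a mod d) = a" using m[OF a] a_le le_antisym by blast
  then have aT: "a \<in> T" unfolding T_def using a by (metis imageI insertI2)
  have bT: "b \<in> T" by (simp add: T_def)
  define pm where "pm = (pow_mono p :: nat \<Rightarrow> 'k ncpoly)"
  have pm_P: "pm i \<in> P i" if "i \<in> I" for i
  proof -
    have "pm i = prod_list (map (\<lambda>x. x ^ p) (map (\<lambda>j. Poly_Mapping.single [j] 1) [1..<i+1]))"
      unfolding pm_def pow_mono_def by (subst single_word) (simp only: prod_list_pow_word map_map comp_def)
    then show ?thesis
      unfolding P_def
      by (intro span_base CollectI exI[of _ "map (\<lambda>j. Poly_Mapping.single [j] 1) [1..<i+1]"] conjI)
        (auto simp: free0_def lookup_single)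
  qed
  have gen: "pm i \<in> U" if "T_space U" "pm ` T \<subseteq> U" "i \<in> I" for U i
  proof -
    have U: "subspace U" using that(1) by (auto simp: subspace_def T_space_def)
    have base: "P j \<subseteq> U" if "j \<in> T" for j
      unfolding P_def
    proof (intro span_minimal U subsetI)
      fix y :: "'k ncpoly"
      assume "y \<in> {prod_list (map (\<lambda>x. x ^ p) xs) | xs. length xs = j \<and> set xs \<subseteq> free0}"
      then obtain xs where xs: "y = prod_list (map (\<lambda>x. x ^ p) xs)" "length xs = j" "set xs \<subseteq> free0"
        by blast
      \<comment> \<open>The variables of \<open>pow_mono\<close> start at 1, list positions at 0;
        all other variables go to 0, which lies in \<open>free0\<close>.\<close>
      define \<sigma> where "\<sigma> i = (if i \<in> {1..j} then xs ! (i - 1) else 0)" for i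
      have "\<sigma> i \<in> free0" for i
      proof (cases "i \<in> {1..j}")
        case True
        then have "xs ! (i - 1) \<in> set xs" using xs(2) by (intro nth_mem) auto
        with True xs(3) show ?thesis unfolding \<sigma>_def by auto
      next
        case False
        then have "\<sigma> i = 0" by (simp only: \<sigma>_def if_False)
        then show ?thesis by (simp add: free0_def)
      qed
      moreover have "pm j \<in> U" using \<open>pm ` T \<subseteq> U\<close> that by auto
      ultimately have "nc_subst \<sigma> (pm j) \<in> U" using \<open>T_space U\<close> by (auto simp: T_space_def)
      moreover have "map (\<lambda>i. \<sigma> i ^ p) [1..<j+1] = map (\<lambda>x. x ^ p) xs"
        using xs(2) by (intro nth_equalityI) (auto simp: \<sigma>_def simp del: upt_Suc)
      moreover have "0 < j" using that T(2) assms(4) by (cases j) auto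
      ultimately show "y \<in> U" using nc_subst_pow_mono[of p j \<sigma>] p_gt_2 xs(1) unfolding pm_def by (metis gr0I not_less0)
    qed
    define r where "r = m (i mod d)"
    have r: "r \<in> T" "r \<in> I" "r mod d = i mod d" "r \<le> i" unfolding r_def T_def using m[OF that(3)] that(3) by (blast, simp_all)
    \<comment> \<open>Climbing in steps of \<open>d\<close> from the class minimum \<open>r\<close>.
      The bound of \<open>P_reduce\<close> fails only for the step from \<open>a\<close> to
      \<open>b\<close>, where \<open>b\<close> itself is a generator; if \<open>r\<close> is not
      \<open>a\<close>, then \<open>r\<close> is at least \<open>b = a + d\<close>.\<close>
    have steps: "P (r + k * d) \<subseteq> U" for k
    proof (induction k)
      case (Suc k)
      show ?case
      proof (cases "r = a \<and> k = 0")
        case True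
        then show ?thesis using base[OF bT] d by simp
      next
        case False
        have "a + 2 * d \<le> r + Suc k * d"
        proof (cases "r = a")
          case True
          then show ?thesis using False by (cases k) auto
        next
          case False
          then show ?thesis using b_le[OF r(2)] d by simp
        qed
        then have "P (r + Suc k * d) \<subseteq> span (P (r + k * d) \<union> P a \<union> P b)"
          using P_reduce[of "r + Suc k * d"] \<open>0 < a\<close> d by auto
        also have "\<dots> \<subseteq> U"
          using span_minimal[OF _ U] Suc.IH base[OF aT] base[OF bT] by simp
        finally show ?thesis .
      qed
    qed (use base r in simp)
    obtain k where "i = r + k * d"
      using r(3,4) by (metis mod_eq_nat1E mult.commute)
    then show ?thesis using steps[of k] pm_P[OF that(3)] by auto
  qed
  show ?thesis
  proof (intro exI[of _ "pm ` T"] conjI)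
    show "finite (pm ` T)" using T by simp
    show "pm ` T \<subseteq> free0"
    proof (intro image_subsetI)
      fix i assume "i \<in> T"
      then have "i \<in> I" "Suc (i - 1) = i" using T(2) assms(4) by (blast, cases i) auto
      then show "pm i \<in> free0" using pm_P P_Suc_subset_A[of "pm i" "i - 1"] by metis
    qed
    show "T_span (pm ` T) = T_span ((\<lambda>i. pow_mono p i) ` I)"
      \<comment> \<open>Both spans are intersections over the same family of T-spaces.\<close>
      unfolding T_span_def pm_def[symmetric] using gen T(2) by (intro arg_cong[of _ _ Inter]) blast
    show "card (pm ` T) \<le> (LEAST i. i \<in> I \<and> i > (LEAST i. i \<in> I)) - (LEAST i. i \<in> I) + 1"
      using card_image_le[OF T(1), of pm] card_T unfolding a_def[symmetric] b_def[symmetric] d_def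
      by linarith
  qed
qed

end
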